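(* The formula $(\overline p\wedge\Box\Box\overline p)\vee\Diamond p$ is absolutely minimal among the set of $\mathsf L_\Diamond$-formulas defining the class of reflexive and transitive frames.
   Context: Fix a countably infinite set of propositional variables $P$. $\mathsf L_\Diamond$ is the set of formulas in negation normal form built from literals $p,\overline p$ ($p\in P$), $\bot$ and $\top$ using $\vee,\wedge,\Diamond,\Box$; $\neg$ and $\to$ are abbreviations via De Morgan's rules. A frame is $(W,R)$ with $W$ nonempty and $R\subseteq W\times W$. A formula is valid on a frame if true at every point under every valuation (standard Kripke semantics). A formula $\varphi$ defines a class $\mathcal F$ of frames if for every frame $\mathcal A$, $\varphi$ is valid on $\mathcal A$ iff $\mathcal A\in\mathcal F$. The complexity measures considered are: the length (number of nodes of the syntax tree, leaves included); for each symbol among $\vee,\wedge,\Diamond,\Box,\bot,\top$, the number of its occurrences; the modal depth; and the number of distinct propositional variables. Given a set $\Gamma$ of formulas and $\varphi\in\Gamma$, $\varphi$ is absolutely minimal among $\Gamma$ if $\mu(\varphi)\leq\mu(\psi)$ for all $\psi\in\Gamma$ and every one of these measures $\mu$. *)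

theory Defs
  imports Main "HOL-Library.Countable_Set"
begin

text \<open>Modal formulas in negation normal form over the variables \<^typ>\<open>'p\<close>.
  A negative literal is an atomic symbol, hence a single leaf of the syntax tree.\<close>

datatype (vars: 'p) fm =
    Pos 'p
  | Neg 'p
  | Bot
  | Top
  | Or "'p fm" "'p fm"
  | And "'p fm" "'p fm"
  | Dia "'p fm"
  | Box "'p fm"

type_synonym 'w frame = "'w set \<times> ('w \<times> 'w) set"

definition is_frame :: "'w frame \<Rightarrow> bool" where
  "is_frame A \<longleftrightarrow> fst A \<noteq> {} \<and> snd A \<subseteq> fst A \<times> fst A"

primrec holds :: "'w frame \<Rightarrow> ('p \<Rightarrow> 'w set) \<Rightarrow> 'w \<Rightarrow> 'p fm \<Rightarrow> bool" where
  "holds A V w (Pos p) \<longleftrightarrow> w \<in> V p"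
| "holds A V w (Neg p) \<longleftrightarrow> w \<notin> V p"
| "holds A V w Bot \<longleftrightarrow> False"
| "holds A V w Top \<longleftrightarrow> True"
| "holds A V w (Or \<phi> \<psi>) \<longleftrightarrow> holds A V w \<phi> \<or> holds A V w \<psi>"
| "holds A V w (And \<phi> \<psi>) \<longleftrightarrow> holds A V w \<phi> \<and> holds A V w \<psi>"
| "holds A V w (Dia \<phi>) \<longleftrightarrow> (\<exists>v. (w, v) \<in> snd A \<and> holds A V v \<phi>)"
| "holds A V w (Box \<phi>) \<longleftrightarrow> (\<forall>v. (w, v) \<in> snd A \<longrightarrow> holds A V v \<phi>)"

definition valid_on :: "'w frame \<Rightarrow> 'p fm \<Rightarrow> bool" where
  "valid_on A \<phi> \<longleftrightarrow>
    (\<forall>V. (\<forall>p. V p \<subseteq> fst A) \<longrightarrow> (\<forall>w \<in> fst A. holds A V w \<phi>))"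

definition fm_defines :: "'p fm \<Rightarrow> 'w frame set \<Rightarrow> bool" where
  "fm_defines \<phi> F \<longleftrightarrow> (\<forall>A. is_frame A \<longrightarrow> (valid_on A \<phi> \<longleftrightarrow> A \<in> F))"

definition refl_trans_frames :: "'w frame set" where
  "refl_trans_frames = {A. is_frame A \<and> refl_on (fst A) (snd A) \<and> trans (snd A)}"

primrec fm_length :: "'p fm \<Rightarrow> nat" where
  "fm_length (Pos p) = 1"
| "fm_length (Neg p) = 1"
| "fm_length Bot = 1"
| "fm_length Top = 1"
| "fm_length (Or \<phi> \<psi>) = 1 + fm_length \<phi> + fm_length \<psi>"
| "fm_length (And \<phi> \<psi>) = 1 + fm_length \<phi> + fm_length \<psi>"
| "fm_length (Dia \<phi>) = 1 + fm_length \<phi>"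
| "fm_length (Box \<phi>) = 1 + fm_length \<phi>"

datatype symbol = Or_sym | And_sym | Dia_sym | Box_sym | Bot_sym | Top_sym

primrec occurrences :: "symbol \<Rightarrow> 'p fm \<Rightarrow> nat" where
  "occurrences s (Pos p) = 0"
| "occurrences s (Neg p) = 0"
| "occurrences s Bot = of_bool (s = Bot_sym)"
| "occurrences s Top = of_bool (s = Top_sym)"
| "occurrences s (Or \<phi> \<psi>) = of_bool (s = Or_sym) + occurrences s \<phi> + occurrences s \<psi>"
| "occurrences s (And \<phi> \<psi>) = of_bool (s = And_sym) + occurrences s \<phi> + occurrences s \<psi>"
| "occurrences s (Dia \<phi>) = of_bool (s = Dia_sym) + occurrences s \<phi>"
| "occurrences s (Box \<phi>) = of_bool (s = Box_sym) + occurrences s \<phi>"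

primrec modal_depth :: "'p fm \<Rightarrow> nat" where
  "modal_depth (Pos p) = 0"
| "modal_depth (Neg p) = 0"
| "modal_depth Bot = 0"
| "modal_depth Top = 0"
| "modal_depth (Or \<phi> \<psi>) = max (modal_depth \<phi>) (modal_depth \<psi>)"
| "modal_depth (And \<phi> \<psi>) = max (modal_depth \<phi>) (modal_depth \<psi>)"
| "modal_depth (Dia \<phi>) = 1 + modal_depth \<phi>"
| "modal_depth (Box \<phi>) = 1 + modal_depth \<phi>"

definition complexity_measures :: "('p fm \<Rightarrow> nat) set" where
  "complexity_measures =
    {fm_length, modal_depth, \<lambda>\<phi>. card (vars \<phi>)} \<union> range occurrences"

definition absolutely_minimal :: "'p fm set \<Rightarrow> 'p fm \<Rightarrow> bool" where
  "absolutely_minimal \<Gamma> \<phi> \<longleftrightarrow>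
    \<phi> \<in> \<Gamma> \<and> (\<forall>\<mu> \<in> complexity_measures. \<forall>\<psi> \<in> \<Gamma>. \<mu> \<phi> \<le> \<mu> \<psi>)"

text \<open>A formula cannot quantify over all types, so the worlds of frames are taken from an
  arbitrary type \<^typ>\<open>'w\<close>; the theorem assumes that type to be infinite and is
  polymorphic in it. On a finite type there are too few frames to tell the class apart:
  with a single possible world every frame is transitive. A formula that defines the class
  among frames of every type in particular does so for each infinite \<^typ>\<open>'w\<close>, so
  minimality for one such type gives minimality among all such formulas.\<close>

end

theory Submission imports Defs begin

text \<open>Every bound is obtained by transferring validity from reflexive transitive frames to a
  frame outside the class, for formulas lacking the resource in question. In most cases the
  target may be any reflexive frame with relation \<open>R\<close>, so a single non-transitive one suffices.
  For instance, if only one box \<open>\<box>\<chi>\<close> occurs, pick for each world \<open>x\<close> a successor \<open>f x\<close> refuting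
  \<open>\<chi>\<close>, with \<open>f x = x\<close> if \<open>x\<close> refutes \<open>\<chi>\<close> or if no successor does. Then \<open>f\<close> is idempotent, so
  the reflexive closure of its graph is a transitive part of \<open>R\<close>, and every formula with
  no other box that is refuted under \<open>R\<close> stays refuted under this part.

  Conjunction is different: the conjunction-free formulas \<open>\<not>p \<or> \<diamond>p\<close> and \<open>\<box>\<box>\<not>p \<or> \<diamond>p\<close> define
  reflexivity and transitivity. Here a refutation on a reflexive non-transitive frame and one on a
  transitive non-reflexive frame are merged into a refutation on a reflexive transitive
  frame. The bound on the length follows from the bounds on the connectives.\<close>

text \<open>A tree with n binary nodes has n + 1 leaves, so counting the connectives already
  determines the length.\<close>

lemma fm_length_eq:
  "fm_length \<phi> = 2 * (occurrences Or_sym \<phi> + occurrences And_sym \<phi>)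
    + occurrences Dia_sym \<phi> + occurrences Box_sym \<phi> + 1"
  by (induction \<phi>) auto

lemma valid_on_UNIV: "valid_on (UNIV, R) \<phi> \<longleftrightarrow> (\<forall>V w. holds (UNIV, R) V w \<phi>)"
  by (simp add: valid_on_def)

lemma fm_defines_refl_trans_UNIV:
  fixes R :: "('w \<times> 'w) set"
  assumes "fm_defines \<phi> (refl_trans_frames :: 'w frame set)"
  shows "valid_on (UNIV, R) \<phi> \<longleftrightarrow> refl R \<and> trans R"
proof -
  have "is_frame (UNIV, R)" by (simp add: is_frame_def)
  with assms show ?thesis by (simp add: fm_defines_def refl_trans_frames_def)
qed

lemma fm_defines_refl_trans:
  "fm_defines (Or (And (Neg p) (Box (Box (Neg p)))) (Dia (Pos p)))
    (refl_trans_frames :: 'w frame set)" (is "fm_defines ?\<phi> _")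
  unfolding fm_defines_def
proof (intro allI impI iffI)
  fix A :: "'w frame"
  assume frame: "is_frame A" and valid: "valid_on A ?\<phi>"
  have edge: "(w, v) \<in> snd A"
    if "w \<in> fst A" "v \<in> fst A" "w = v \<or> (\<exists>u. (w, u) \<in> snd A \<and> (u, v) \<in> snd A)" for w v
  proof -
    \<comment> \<open>With \<open>p\<close> true at \<open>v\<close> alone, the left disjunct fails
      at \<open>w\<close>, since \<open>v\<close> is reached in zero or two steps. The diamond then
      forces the edge.\<close>
    have "holds A (\<lambda>_. {v}) w ?\<phi>"
      using valid[unfolded valid_on_def, rule_format, of "\<lambda>_. {v}" w] that(1,2) by simp
    with that(3) show ?thesis by auto
  qed
  have "refl_on (fst A) (snd A)"
    using edge by (auto simp: refl_on_def)
  moreover have "trans (snd A)"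
    using frame by (auto intro!: transI edge simp: is_frame_def)
  ultimately show "A \<in> refl_trans_frames"
    using frame by (simp add: refl_trans_frames_def)
next
  fix A :: "'w frame"
  assume "A \<in> refl_trans_frames"
  then have "\<forall>w \<in> fst A. (w, w) \<in> snd A" "trans (snd A)"
    by (auto simp: refl_trans_frames_def refl_on_def)
  then show "valid_on A ?\<phi>"
    by (auto simp: valid_on_def dest: transD)
qed

section \<open>Transfer of truth between models\<close>

lemma holds_var_free_serial:
  assumes "vars \<phi> = {}" "\<And>w. \<exists>v. (w, v) \<in> snd A" "\<And>w. \<exists>v. (w, v) \<in> snd B"
  shows "holds A V w \<phi> \<longleftrightarrow> holds B U u \<phi>"
  \<comment> \<open>On a serial frame, \<open>Dia\<close> and \<open>Box\<close> both preserve a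
    constant truth value.\<close>
  using assms by (induction \<phi> arbitrary: w u) (auto; metis)+

text \<open>Only a disjunction requires two refutations under one valuation. Without it, a single
  branch down to one leaf suffices: one conjunct, or any successor for a diamond. A constant
  valuation refutes a literal there, and on \<open>Id\<close> modalities do nothing.\<close>

lemma or_free_refuted_Id:
  assumes "\<not> holds A U u \<phi>" "occurrences Or_sym \<phi> = 0" "\<And>x. \<exists>y. (x, y) \<in> snd A"
  obtains V where "\<not> holds (UNIV, Id) V w \<phi>"
proof -
  have "\<exists>V. \<not> holds (UNIV, Id) V w \<phi>"
    using assms(1,2)
  proof (induction \<phi> arbitrary: u)
    case (Pos x)
    have "\<not> holds (UNIV, Id) (\<lambda>_. {}) w (Pos x)" by simp
    then show ?case by blast
  next
    case (Neg x)
    have "\<not> holds (UNIV, Id) (\<lambda>_. UNIV) w (Neg x)" by simp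
    then show ?case by blast
  next
    case (And \<phi> \<psi>)
    then show ?case by (auto; blast)
  next
    case (Dia \<phi>)
    moreover obtain v where "(u, v) \<in> snd A" using assms(3) by blast
    ultimately show ?case by auto
  qed auto
  then show ?thesis using that by blast
qed

lemma holds_dia_free_mono:
  assumes "holds A V w \<phi>" "occurrences Dia_sym \<phi> = 0" "snd B \<subseteq> snd A"
  shows "holds B V w \<phi>"
  using assms by (induction \<phi> arbitrary: w) auto

lemma holds_box_free_mono:
  assumes "holds A V w \<phi>" "occurrences Box_sym \<phi> = 0" "snd A \<subseteq> snd B"
  shows "holds B V w \<phi>"
  using assms by (induction \<phi> arbitrary: w) auto

lemma at_most_one_box_refl_trans_part:
  assumes "occurrences Box_sym \<phi> \<le> 1" "refl R"
  obtains R' where "refl R'" "trans R'" "R' \<subseteq> R"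
    "\<And>w. holds (W, R') V w \<phi> \<Longrightarrow> holds (W, R) V w \<phi>"
proof -
  have Id: "refl Id" "trans Id" "Id \<subseteq> R"
    using assms(2) by (auto simp: refl_on_def trans_def)
  have mono: "holds (W, R) V w \<psi>"
    if "occurrences Box_sym \<psi> = 0" "R' \<subseteq> R" "holds (W, R') V w \<psi>" for R' w \<psi>
    using holds_box_free_mono[OF that(3,1)] that(2) by simp
  have "\<exists>R'. refl R' \<and> trans R' \<and> R' \<subseteq> R \<and> (\<forall>w. holds (W, R') V w \<phi> \<longrightarrow> holds (W, R) V w \<phi>)"
    using assms(1)
  proof (induction \<phi>)
    case (Or \<phi> \<psi>)
    \<comment> \<open>The box lies in at most one disjunct. The part of \<open>R\<close> found for
      that one serves for both, as the other is box-free and hence monotone in the relation.\<close>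
    then consider "occurrences Box_sym \<phi> = 0" "occurrences Box_sym \<psi> \<le> 1"
      | "occurrences Box_sym \<psi> = 0" "occurrences Box_sym \<phi> \<le> 1" by fastforce
    then show ?case
      using Or.IH mono by cases (simp, meson)+
  next
    case (And \<phi> \<psi>)
    then consider "occurrences Box_sym \<phi> = 0" "occurrences Box_sym \<psi> \<le> 1"
      | "occurrences Box_sym \<psi> = 0" "occurrences Box_sym \<phi> \<le> 1" by fastforce
    then show ?case
      using And.IH mono by cases (simp, meson)+
  next
    case (Dia \<phi>)
    then obtain R' where "refl R'" "trans R'" "R' \<subseteq> R"
      "\<forall>w. holds (W, R') V w \<phi> \<longrightarrow> holds (W, R) V w \<phi>" by auto
    then show ?case by (intro exI[of _ R']) auto
  next
    case (Box \<phi>)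
    then have box_free: "occurrences Box_sym \<phi> = 0" by simp
    define bad where "bad x y \<longleftrightarrow> (x, y) \<in> R \<and> \<not> holds (W, R) V y \<phi>" for x y
    define f where "f x = (if (\<exists>y. bad x y) \<and> \<not> bad x x then SOME y. bad x y else x)" for x
    have refl: "(x, x) \<in> R" for x
      using assms(2) by (simp add: refl_on_def)
    have f_bad: "bad x (f x)" if "bad x y" for x y
      using that by (auto simp: f_def intro: someI)
    have f_edge: "(x, f x) \<in> R" for x
      using f_bad refl by (metis bad_def f_def)
    \<comment> \<open>If \<open>f\<close> moves \<open>x\<close>, then \<open>f x\<close> refutes
      the body and sees itself, so \<open>bad (f x) (f x)\<close> holds and \<open>f\<close> fixes
      it.\<close>
    have f_idem: "f (f x) = f x" for x
      using f_bad refl by (metis bad_def f_def)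
    let ?R' = "{(x, y). y = x \<or> y = f x}"
    have "refl ?R'" "trans ?R'" and sub: "?R' \<subseteq> R"
      using refl f_edge f_idem by (auto simp: refl_on_def trans_def)
    moreover have "holds (W, R) V w (Box \<phi>)" if "holds (W, ?R') V w (Box \<phi>)" for w
    proof -
      have "holds (W, ?R') V (f w) \<phi>" using that by simp
      then have "holds (W, R) V (f w) \<phi>" using mono box_free sub by blast
      then show ?thesis using f_bad unfolding bad_def by auto
    qed
    ultimately show ?case by blast
  qed (use Id in auto)
  then obtain R' where "refl R'" "trans R'" "R' \<subseteq> R"
    "\<forall>w. holds (W, R') V w \<phi> \<longrightarrow> holds (W, R) V w \<phi>" by auto
  then show ?thesis using that[of R'] by simp
qed

lemma holds_depth_0:
  assumes "modal_depth \<phi> = 0"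
  shows "holds A V w \<phi> \<longleftrightarrow> holds B V w \<phi>"
  using assms by (induction \<phi>) auto

text \<open>Below a single modality the relation is no longer consulted.\<close>

lemma holds_depth_1:
  assumes "modal_depth \<phi> \<le> 1" "snd A `` {w} = snd B `` {w}"
  shows "holds A V w \<phi> \<longleftrightarrow> holds B V w \<phi>"
  using assms(1)
proof (induction \<phi>)
  case (Dia \<phi>)
  then have "holds A V v \<phi> \<longleftrightarrow> holds B V v \<phi>" for v
    by (intro holds_depth_0) simp
  then show ?case using assms(2) by auto
next
  case (Box \<phi>)
  then have "holds A V v \<phi> \<longleftrightarrow> holds B V v \<phi>" for v
    by (intro holds_depth_0) simp
  then show ?case using assms(2) by auto
qed auto

text \<open>The generated-submodel principle: evaluation that starts in \<open>S\<close> never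
  leaves it.\<close>

lemma holds_closed_subset:
  assumes "w \<in> S" "\<And>x. x \<in> S \<Longrightarrow> snd A `` {x} = snd B `` {x} \<and> snd A `` {x} \<subseteq> S"
  shows "holds A V w \<phi> \<longleftrightarrow> holds B V w \<phi>"
  using assms(1)
proof (induction \<phi> arbitrary: w)
  case (Dia \<phi>)
  then show ?case using assms(2)[OF Dia.prems] by (auto; blast)
next
  case (Box \<phi>)
  then show ?case using assms(2)[OF Box.prems] by (auto; blast)
qed auto

text \<open>Read contrapositively, this merges two refutations into one. \<open>Z\<close> acts as a
  bisimulation between \<open>A\<close> and pairs of worlds, except that a literal need only be
  refuted in \<open>A\<close> when both sides refute it. A conjunction would break this, as the two
  sides could refute different conjuncts.\<close>

lemma holds_and_free_join:
  assumes "occurrences And_sym \<phi> = 0" "Z w w1 w2" "holds A V w \<phi>"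
    and pos: "\<And>w w1 w2 p. Z w w1 w2 \<Longrightarrow> w \<in> V p \<Longrightarrow> w1 \<in> V1 p \<or> w2 \<in> V2 p"
    and neg: "\<And>w w1 w2 p. Z w w1 w2 \<Longrightarrow> w \<notin> V p \<Longrightarrow> w1 \<notin> V1 p \<or> w2 \<notin> V2 p"
    and zig: "\<And>w w1 w2 v. Z w w1 w2 \<Longrightarrow> (w, v) \<in> snd A \<Longrightarrow>
      \<exists>v1 v2. (w1, v1) \<in> snd A1 \<and> (w2, v2) \<in> snd A2 \<and> Z v v1 v2"
    and zag: "\<And>w w1 w2 v1 v2. Z w w1 w2 \<Longrightarrow> (w1, v1) \<in> snd A1 \<Longrightarrow> (w2, v2) \<in> snd A2 \<Longrightarrow>
      \<exists>v. (w, v) \<in> snd A \<and> Z v v1 v2"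
  shows "holds A1 V1 w1 \<phi> \<or> holds A2 V2 w2 \<phi>"
  using assms(1-3)
proof (induction \<phi> arbitrary: w w1 w2)
  case (Pos p)
  then show ?case using pos by simp
next
  case (Neg p)
  then show ?case using neg by simp
next
  case (Or \<phi> \<psi>)
  then show ?case by (auto; blast)
next
  case (Dia \<phi>)
  then obtain v where "(w, v) \<in> snd A" "holds A V v \<phi>" by auto
  moreover from this(1) obtain v1 v2
    where "(w1, v1) \<in> snd A1" "(w2, v2) \<in> snd A2" "Z v v1 v2"
    using zig Dia.prems(2) by blast
  ultimately show ?case using Dia.IH[of v v1 v2] Dia.prems(1) by auto
next
  case (Box \<phi>)
  show ?case
  proof (rule ccontr)
    assume "\<not> ?thesis"
    then obtain v1 v2 where v: "(w1, v1) \<in> snd A1" "\<not> holds A1 V1 v1 \<phi>"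
      "(w2, v2) \<in> snd A2" "\<not> holds A2 V2 v2 \<phi>" by auto
    then obtain u where "(w, u) \<in> snd A" "Z u v1 v2"
      using zag Box.prems(2) by blast
    then show False using v Box.IH[of u v1 v2] Box.prems by auto
  qed
qed auto

section \<open>Lower bounds for a defining formula\<close>

context
  fixes \<phi> :: "'p fm" and a b c :: 'w
  assumes def_S4: "fm_defines \<phi> (refl_trans_frames :: 'w frame set)"
    and distinct: "a \<noteq> b" "b \<noteq> c" "a \<noteq> c"
begin

private definition chain :: "('w \<times> 'w) set" where
  "chain = Id \<union> {(a, b), (b, c)}"

private lemma refl_chain: "refl chain"
  by (auto simp: chain_def refl_on_def)

private lemma holds_refl_trans:
  assumes "refl R" "trans R"
  shows "holds (UNIV, R) V (w :: 'w) \<phi>"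
  using fm_defines_refl_trans_UNIV[OF def_S4, of R] assms by (simp add: valid_on_UNIV)

private lemma holds_Id: "holds (UNIV, Id) V (w :: 'w) \<phi>"
  by (intro holds_refl_trans) (auto simp: refl_on_def trans_def)

private lemma refuted_outside:
  assumes "\<not> (refl R \<and> trans R)"
  obtains V and w :: 'w where "\<not> holds (UNIV, R) V w \<phi>"
  using fm_defines_refl_trans_UNIV[OF def_S4, of R] assms by (auto simp: valid_on_UNIV)

private lemma refuted_on_chain:
  obtains V w where "\<not> holds (UNIV, chain) V w \<phi>"
proof (rule refuted_outside)
  have "(a, c) \<notin> chain" "(a, b) \<in> chain" "(b, c) \<in> chain"
    using distinct by (auto simp: chain_def)
  then show "\<not> (refl chain \<and> trans chain)" by (meson transD)
qed

lemma defining_vars: "vars \<phi> \<noteq> {}"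
proof
  assume "vars \<phi> = {}"
  moreover obtain V w where "\<not> holds (UNIV, chain) V w \<phi>"
    by (rule refuted_on_chain)
  ultimately show False
    using holds_var_free_serial[of \<phi> "(UNIV, Id)" "(UNIV, chain)" V w V w] holds_Id
    by (auto simp: chain_def)
qed

lemma defining_Or: "occurrences Or_sym \<phi> \<ge> 1"
proof (rule ccontr)
  assume "\<not> ?thesis"
  then have or_free: "occurrences Or_sym \<phi> = 0" by simp
  obtain V w where V: "\<not> holds (UNIV, chain) V w \<phi>"
    by (rule refuted_on_chain)
  have serial: "\<exists>y. (x, y) \<in> snd (UNIV :: 'w set, chain)" for x
    by (auto simp: chain_def)
  obtain V' where "\<not> holds (UNIV, Id) V' w \<phi>"
    using V or_free serial by (rule or_free_refuted_Id)
  then show False using holds_Id by simp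
qed

lemma defining_Dia: "occurrences Dia_sym \<phi> \<ge> 1"
proof (rule ccontr)
  assume "\<not> ?thesis"
  \<comment> \<open>The empty relation is not reflexive but lies inside \<open>Id\<close>, and
    diamond-free truth survives removing edges.\<close>
  moreover have "\<not> (refl {} \<and> trans ({} :: ('w \<times> 'w) set))"
    by (simp add: refl_on_def)
  then obtain V and w :: 'w where "\<not> holds (UNIV, {}) V w \<phi>"
    by (rule refuted_outside)
  ultimately show False
    using holds_dia_free_mono[of "(UNIV, Id)" V w \<phi> "(UNIV, {})"] holds_Id by auto
qed

lemma defining_Box: "occurrences Box_sym \<phi> \<ge> 2"
proof (rule ccontr)
  assume "\<not> ?thesis"
  then have box: "occurrences Box_sym \<phi> \<le> 1" by simp
  obtain V w where V: "\<not> holds (UNIV, chain) V w \<phi>"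
    by (rule refuted_on_chain)
  show False
  proof (rule at_most_one_box_refl_trans_part[OF box refl_chain, of UNIV V])
    fix R' assume "refl R'" "trans R'"
      and "\<And>w. holds (UNIV, R') V w \<phi> \<Longrightarrow> holds (UNIV, chain) V w \<phi>"
    then show False using V holds_refl_trans[of R' V w] by simp
  qed
qed

lemma defining_depth: "modal_depth \<phi> \<ge> 2"
proof (rule ccontr)
  assume "\<not> ?thesis"
  then have depth: "modal_depth \<phi> \<le> 1" by simp
  obtain V w where V: "\<not> holds (UNIV, chain) V w \<phi>"
    by (rule refuted_on_chain)
  \<comment> \<open>Only \<open>w\<close> keeps proper successors, which makes the relation
    transitive without changing what \<open>w\<close> sees.\<close>
  let ?R = "Id \<union> {w} \<times> chain `` {w}"
  have "holds (UNIV, ?R) V w \<phi>"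
    by (rule holds_refl_trans) (auto simp: refl_on_def trans_def)
  moreover have "?R `` {w} = chain `` {w}"
    by (auto simp: chain_def)
  ultimately show False
    using V holds_depth_1[OF depth, of "(UNIV, ?R)" w "(UNIV, chain)" V] by simp
qed

lemma defining_And: "occurrences And_sym \<phi> \<ge> 1"
proof (rule ccontr)
  assume "\<not> ?thesis"
  then have and_free: "occurrences And_sym \<phi> = 0" by simp
  \<comment> \<open>Transitive, but \<open>a\<close> has lost its loop and sees only
    \<open>b\<close>.\<close>
  let ?S = "insert (a, b) (Id - {(a, a)})"
  obtain V1 w1 where V1: "\<not> holds (UNIV, chain) V1 w1 \<phi>"
    by (rule refuted_on_chain)
  have "\<not> (refl ?S \<and> trans ?S)"
    using distinct by (auto simp: refl_on_def)
  then obtain V2 w2 where V2: "\<not> holds (UNIV, ?S) V2 w2 \<phi>"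
    by (rule refuted_outside)
  \<comment> \<open>From any world other than \<open>a\<close>, both frames look reflexive and
    transitive, so the refutations must sit at \<open>a\<close>.\<close>
  have w1: "w1 = a"
  proof (rule ccontr)
    assume "w1 \<noteq> a"
    moreover have "holds (UNIV, insert (b, c) Id) V1 w1 \<phi>"
      by (rule holds_refl_trans) (auto simp: refl_on_def trans_def)
    ultimately show False
      using V1 distinct holds_closed_subset[of w1 "- {a}" "(UNIV, insert (b, c) Id)" "(UNIV, chain)"]
      by (auto simp: chain_def)
  qed
  have w2: "w2 = a"
  proof (rule ccontr)
    assume "w2 \<noteq> a"
    then show False
      using V2 holds_Id holds_closed_subset[of w2 "- {a}" "(UNIV, Id)" "(UNIV, ?S)"]
      by auto
  qed
  \<comment> \<open>The loop at \<open>a\<close> in the merged frame is matched by the loop at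
    \<open>a\<close> in \<open>chain\<close> and the edge from \<open>a\<close> to \<open>b\<close>
    in \<open>?S\<close>. The loop at \<open>b\<close> also absorbs the step from \<open>b\<close>
    to \<open>c\<close> in \<open>chain\<close>.\<close>
  define Z where "Z w x y \<longleftrightarrow> w = a \<and> x = a \<and> (y = a \<or> y = b) \<or> w = b \<and> (x = b \<or> x = c) \<and> y = b"
    for w x y
  \<comment> \<open>Under \<open>Z\<close>, world \<open>a\<close> always has first partner
    \<open>a\<close>, and \<open>b\<close> always has second partner \<open>b\<close>. Copying
    \<open>V1\<close> at \<open>a\<close> and \<open>V2\<close> at \<open>b\<close> therefore
    settles all literals.\<close>
  let ?V = "\<lambda>p. {w. w = a \<and> a \<in> V1 p \<or> w = b \<and> b \<in> V2 p}"
  have "holds (UNIV, insert (a, b) Id) ?V a \<phi>"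
    by (rule holds_refl_trans) (auto simp: refl_on_def trans_def)
  then have "holds (UNIV, chain) V1 a \<phi> \<or> holds (UNIV, ?S) V2 a \<phi>"
    by (rule holds_and_free_join[OF and_free, where Z = Z, rotated])
      (use distinct in \<open>auto simp: Z_def chain_def\<close>)
  then show False using V1 V2 w1 w2 by blast
qed

end

theorem theorem7p1:
  fixes p :: 'p
  assumes "countable (UNIV :: 'p set)" and "infinite (UNIV :: 'p set)"
    and "infinite (UNIV :: 'w set)"
  shows "absolutely_minimal
           {\<phi> :: 'p fm. fm_defines \<phi> (refl_trans_frames :: 'w frame set)}
           (Or (And (Neg p) (Box (Box (Neg p)))) (Dia (Pos p)))"
proof -
  obtain S :: "'w set" where "card S = 3"
    using infinite_arbitrarily_large[OF assms(3)] by blast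
  then obtain a b c :: 'w where distinct: "a \<noteq> b" "b \<noteq> c" "a \<noteq> c"
    by (auto simp: card_3_iff)
  have "\<mu> (Or (And (Neg p) (Box (Box (Neg p)))) (Dia (Pos p))) \<le> \<mu> \<psi>"
    if \<mu>: "\<mu> \<in> complexity_measures"
      and \<psi>: "fm_defines \<psi> (refl_trans_frames :: 'w frame set)" for \<mu> and \<psi> :: "'p fm"
  proof -
    note bounds = defining_Or[OF \<psi> distinct] defining_And[OF \<psi> distinct]
      defining_Dia[OF \<psi> distinct] defining_Box[OF \<psi> distinct]
    have vars: "card (vars \<psi>) \<ge> 1"
      using defining_vars[OF \<psi> distinct] by (simp add: Suc_le_eq card_gt_0_iff fm.set_finite)
    consider "\<mu> = fm_length" | "\<mu> = modal_depth" | "\<mu> = (\<lambda>\<phi>. card (vars \<phi>))"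
      | s where "\<mu> = occurrences s"
      using \<mu> by (auto simp: complexity_measures_def)
    then show ?thesis
    proof cases
      case 1
      then show ?thesis using bounds by (simp add: fm_length_eq)
    next
      case 2
      then show ?thesis using defining_depth[OF \<psi> distinct] by simp
    next
      case 3
      then show ?thesis using vars by simp
    next
      case 4
      then show ?thesis using bounds by (cases s) simp_all
    qed
  qed
  then show ?thesis
    by (simp add: absolutely_minimal_def fm_defines_refl_trans)
qed

end
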